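(* Let $N\in\mathbb{N}$, $N\geq 2$, and let $(S_j)_{0\leq j<N}$ be a representation of the Cuntz algebra $\mathcal{O}_N$ on a Hilbert space $\mathcal{H}$, with corresponding projection valued measure $P$ on the Borel subsets of $[0,1)$. Suppose there is a solution $f\in\mathcal{H}$, $\|f\|=1$, to the eigenvalue problem $$S_j^{*}f=\lambda_jf,\qquad 0\leq j<N,$$ for some $\lambda_j\in\mathbb{C}$. Then $\sum_{j=0}^{N-1}|\lambda_j|^{2}=1$, and the measure $\mu:=\|P(\cdot)f\|^{2}$ satisfies $$\mu=\sum_{j=0}^{N-1}|\lambda_j|^{2}\,\mu\circ\sigma_j^{-1},$$ where $\sigma_j(x)=\frac{x+j}{N}$, $\mu\circ\sigma_j^{-1}(E)=\mu(\sigma_j^{-1}(E))$ for Borel sets $E\subset[0,1)$, and $\sigma_j^{-1}(E):=\{x\mid\sigma_j(x)\in E\}$.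
   Context: A representation of the Cuntz algebra $\mathcal{O}_N$ on $\mathcal{H}$ is a system $(S_j)_{0\leq j<N}$ of bounded operators on $\mathcal{H}$ with $S_j^{*}S_k=\delta_{j,k}I$ and $\sum_{j=0}^{N-1}S_jS_j^{*}=I$. The corresponding projection valued measure $P$ is the (countably additive) Borel measure on $[0,1)$, with values in the orthogonal projections of $\mathcal{H}$, such that $$P\left(\left[\tfrac{i_1}{N}+\cdots+\tfrac{i_k}{N^k},\ \tfrac{i_1}{N}+\cdots+\tfrac{i_k}{N^k}+\tfrac{1}{N^k}\right)\right)=S_{i_1}\cdots S_{i_k}S_{i_k}^{*}\cdots S_{i_1}^{*}$$ for all $k\ge 1$ and $i_1,\dots,i_k\in\{0,\dots,N-1\}$. $P$ is taken as given with this property. *)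

theory Defs
  imports "HOL-Analysis.Analysis"
begin

section \<open>Complex Hilbert spaces and their operators\<close>

text \<open>The inner product is linear in its first argument. Positive definiteness follows from
  the last axiom, since \<^term>\<open>norm\<close> is a norm.\<close>

class complex_hilbert_space = banach +
  fixes scaleC :: "complex \<Rightarrow> 'a \<Rightarrow> 'a"  (infixr \<open>*\<^sub>C\<close> 75)
    and cinner :: "'a \<Rightarrow> 'a \<Rightarrow> complex"
  assumes scaleC_add_right: "a *\<^sub>C (x + y) = a *\<^sub>C x + a *\<^sub>C y"
    and scaleC_add_left: "(a + b) *\<^sub>C x = a *\<^sub>C x + b *\<^sub>C x"
    and scaleC_scaleC: "a *\<^sub>C b *\<^sub>C x = (a * b) *\<^sub>C x"
    and scaleR_scaleC: "r *\<^sub>R x = complex_of_real r *\<^sub>C x"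
    and cinner_commute: "cinner x y = cnj (cinner y x)"
    and cinner_add_left: "cinner (x + y) z = cinner x z + cinner y z"
    and cinner_scaleC_left: "cinner (a *\<^sub>C x) y = a * cinner x y"
    and cinner_self: "cinner x x = complex_of_real ((norm x)\<^sup>2)"

definition bounded_clinear ::
  "('a::complex_hilbert_space \<Rightarrow> 'b::complex_hilbert_space) \<Rightarrow> bool" where
  "bounded_clinear T \<longleftrightarrow> bounded_linear T \<and> (\<forall>c x. T (c *\<^sub>C x) = c *\<^sub>C T x)"

definition cadjoint ::
  "('a::complex_hilbert_space \<Rightarrow> 'b::complex_hilbert_space) \<Rightarrow> 'b \<Rightarrow> 'a" where
  "cadjoint T = (THE T'. \<forall>x y. cinner (T x) y = cinner x (T' y))"

definition orthogonal_projection :: "('a::complex_hilbert_space \<Rightarrow> 'a) \<Rightarrow> bool" where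
  "orthogonal_projection Q \<longleftrightarrow>
     bounded_clinear Q \<and> (\<forall>x. Q (Q x) = Q x) \<and> (\<forall>x y. cinner (Q x) y = cinner x (Q y))"

section \<open>Representations of the Cuntz algebra\<close>

definition cuntz_representation ::
  "nat \<Rightarrow> (nat \<Rightarrow> 'a::complex_hilbert_space \<Rightarrow> 'a) \<Rightarrow> bool" where
  "cuntz_representation N S \<longleftrightarrow>
     (\<forall>j<N. bounded_clinear (S j)) \<and>
     (\<forall>j<N. \<forall>k<N. \<forall>x. cadjoint (S j) (S k x) = (if j = k then x else 0)) \<and>
     (\<forall>x. (\<Sum>j<N. S j (cadjoint (S j) x)) = x)"

text \<open>The product \<open>T\<^bsub>i1\<^esub> \<dots> T\<^bsub>ik\<^esub>\<close> along a word \<open>[i1, \<dots>, ik]\<close>.\<close>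

definition word_op :: "(nat \<Rightarrow> 'a \<Rightarrow> 'a) \<Rightarrow> nat list \<Rightarrow> 'a \<Rightarrow> 'a" where
  "word_op T is = foldr (\<lambda>i U. T i \<circ> U) is id"

section \<open>Projection valued measures\<close>

text \<open>Countable additivity is with respect to the strong operator topology.\<close>

definition projection_valued_measure ::
  "'b measure \<Rightarrow> ('b set \<Rightarrow> 'a::complex_hilbert_space \<Rightarrow> 'a) \<Rightarrow> bool" where
  "projection_valued_measure M P \<longleftrightarrow>
     (\<forall>E\<in>sets M. orthogonal_projection (P E)) \<and>
     (\<forall>x. P {} x = 0) \<and>
     (\<forall>A. range A \<subseteq> sets M \<longrightarrow> disjoint_family A \<longrightarrow>
        (\<forall>x. (\<lambda>n::nat. P (A n) x) sums P (\<Union>n. A n) x))"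

definition pvm_measure ::
  "'b measure \<Rightarrow> ('b set \<Rightarrow> 'a::complex_hilbert_space \<Rightarrow> 'a) \<Rightarrow> 'a \<Rightarrow> 'b measure" where
  "pvm_measure M P f = measure_of (space M) (sets M) (\<lambda>E. ennreal ((norm (P E f))\<^sup>2))"

lemma orthogonal_projection_norm:
  assumes "orthogonal_projection Q"
  shows "(norm (Q x))\<^sup>2 = Re (cinner (Q x) x)"
proof -
  have "cinner (Q x) x = cinner (Q x) (Q x)"
    using assms unfolding orthogonal_projection_def by metis
  then show ?thesis by (simp add: cinner_self)
qed

lemma bounded_linear_Re_cinner_left:
  "bounded_linear (\<lambda>x::'a::complex_hilbert_space. Re (cinner x y))"
proof (rule bounded_linear_intro)
  fix x z :: 'a and r :: real
  show "Re (cinner (x + z) y) = Re (cinner x y) + Re (cinner z y)"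
    by (simp add: cinner_add_left)
  show "Re (cinner (r *\<^sub>R x) y) = r *\<^sub>R Re (cinner x y)"
    by (simp add: scaleR_scaleC cinner_scaleC_left)
next
  fix x :: 'a
  have sq: "(norm (u + v))\<^sup>2 = (norm u)\<^sup>2 + 2 * Re (cinner u v) + (norm v)\<^sup>2" for u v :: 'a
  proof -
    have "cinner u (u + v) = cinner u u + cinner u v" "cinner v (u + v) = cinner v u + cinner v v"
      by (metis cinner_add_left cinner_commute complex_cnj_add)+
    then have "cinner (u + v) (u + v) = cinner u u + cinner u v + cinner v u + cinner v v"
      by (simp add: cinner_add_left)
    moreover have "Re (cinner v u) = Re (cinner u v)"
      by (subst cinner_commute) simp
    ultimately show ?thesis
      by (metis (no_types, lifting) Re_complex_of_real cinner_self mult_2 plus_complex.sel(1)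
          add.assoc)
  qed
  have neg: "cinner (- x) y = - cinner x y" for x :: 'a
    using cinner_scaleC_left[of "-1" x y] scaleR_scaleC[of "-1" x] by simp
  have *: "Re (cinner x y) \<le> norm x * norm y" for x :: 'a
  proof -
    have "(norm (x + y))\<^sup>2 \<le> (norm x + norm y)\<^sup>2"
      by (simp add: norm_triangle_ineq power_mono)
    then show ?thesis using sq[of x y] by (simp add: power2_sum)
  qed
  show "norm (Re (cinner x y)) \<le> norm x * norm y"
    using *[of x] *[of "- x"] by (simp add: neg)
qed

text \<open>Without countable additivity \<^const>\<open>measure_of\<close> would silently yield the null measure;
  this is what rules that out.\<close>

lemma emeasure_pvm_measure:
  assumes pvm: "projection_valued_measure M P" and E: "E \<in> sets M"
  shows "emeasure (pvm_measure M P f) E = ennreal ((norm (P E f))\<^sup>2)"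
  unfolding pvm_measure_def
proof (rule emeasure_measure_of_sigma)
  show "sigma_algebra (space M) (sets M)" by (rule sets.sigma_algebra_axioms)
  show "positive (sets M) (\<lambda>E. ennreal ((norm (P E f))\<^sup>2))"
    using pvm by (simp add: positive_def projection_valued_measure_def)
  show "countably_additive (sets M) (\<lambda>E. ennreal ((norm (P E f))\<^sup>2))"
  proof (rule countably_additiveI)
    fix A :: "nat \<Rightarrow> _"
    assume A: "range A \<subseteq> sets M" "disjoint_family A" "(\<Union>i. A i) \<in> sets M"
    have nrm: "(norm (P E f))\<^sup>2 = Re (cinner (P E f) f)" if "E \<in> sets M" for E
      using pvm that by (simp add: orthogonal_projection_norm projection_valued_measure_def)
    have "(\<lambda>n. P (A n) f) sums P (\<Union>n. A n) f"
      using pvm A by (simp add: projection_valued_measure_def)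
    then have "(\<lambda>n. Re (cinner (P (A n) f) f)) sums Re (cinner (P (\<Union>n. A n) f) f)"
      by (rule bounded_linear.sums[OF bounded_linear_Re_cinner_left])
    then have "(\<lambda>n. (norm (P (A n) f))\<^sup>2) sums (norm (P (\<Union>n. A n) f))\<^sup>2"
      using A nrm by (simp add: range_subsetD)
    then show "(\<Sum>i. ennreal ((norm (P (A i) f))\<^sup>2)) = ennreal ((norm (P (\<Union>i. A i) f))\<^sup>2)"
      by (intro suminf_ennreal_eq) simp_all
  qed
qed (use E in auto)

section \<open>The projection valued measure of a Cuntz representation\<close>

definition unit_borel :: "real measure" where
  "unit_borel = restrict_space borel {0..<1}"

definition nadic_interval :: "nat \<Rightarrow> nat list \<Rightarrow> real set" where
  "nadic_interval N is =
     (let a = \<Sum>m<length is. real (is ! m) / real N ^ Suc m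
      in {a..<a + 1 / real N ^ length is})"

definition cuntz_pvm ::
  "nat \<Rightarrow> (nat \<Rightarrow> 'a::complex_hilbert_space \<Rightarrow> 'a) \<Rightarrow> (real set \<Rightarrow> 'a \<Rightarrow> 'a) \<Rightarrow> bool" where
  "cuntz_pvm N S P \<longleftrightarrow>
     projection_valued_measure unit_borel P \<and>
     (\<forall>is. is \<noteq> [] \<longrightarrow> set is \<subseteq> {..<N} \<longrightarrow>
        P (nadic_interval N is) = word_op S is \<circ> word_op (\<lambda>i. cadjoint (S i)) (rev is))"

definition sigma_map :: "nat \<Rightarrow> nat \<Rightarrow> real \<Rightarrow> real" where
  "sigma_map N j x = (x + real j) / real N"

end

theory Submission imports Defs
begin

text \<open>Since \<open>S\<^sub>w\<close> is an isometry and \<open>S\<^sub>w\<^sup>* f = \<lambda>\<^sub>w f\<close>, the measure \<open>\<mu>\<close> gives the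
  \<open>N\<close>-adic interval of a word \<open>w\<close> the mass \<open>|\<lambda>\<^sub>w|\<^sup>2\<close>, a product over the letters. As \<open>\<sigma>\<^sub>j\<close> prepends the
  letter \<open>j\<close>, both sides of the claim agree on these intervals, which form (with the
  empty set) a generating \<open>\<pi>\<close>-system of the Borel sets.\<close>

section \<open>Riesz representation and adjoints\<close>

lemma cinner_add_right: "cinner x (y + z) = cinner x y + cinner x z"
  by (metis cinner_add_left cinner_commute complex_cnj_add)

lemma cinner_scaleC_right: "cinner x (a *\<^sub>C y) = cnj a * cinner x y"
  by (metis cinner_scaleC_left cinner_commute complex_cnj_mult)

lemma cinner_scaleR_right: "cinner x (r *\<^sub>R y) = of_real r * cinner x y"
  by (simp add: scaleR_scaleC cinner_scaleC_right)

lemma cinner_zero_left [simp]: "cinner 0 y = 0"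
  using cinner_add_left[of 0 0 y] by simp

lemma cinner_zero_right [simp]: "cinner x 0 = 0"
  using cinner_add_right[of x 0 0] by simp

lemma cinner_minus_right: "cinner x (- y) = - cinner x y"
  using cinner_add_right[of x y "- y"] by (simp add: eq_neg_iff_add_eq_0 add.commute)

lemma cinner_diff_right: "cinner x (y - z) = cinner x y - cinner x z"
  using cinner_add_right[of x y "- z"] by (simp add: cinner_minus_right)

lemma cinner_sum_left: "cinner (\<Sum>i\<in>A. g i) y = (\<Sum>i\<in>A. cinner (g i) y)"
  by (induction A rule: infinite_finite_induct) (simp_all add: cinner_add_left)

text \<open>Testing against \<open>y - z\<close> forces its norm to be 0. This is what makes an
  adjoint unique, so that the description defining \<open>cadjoint\<close> can be resolved.\<close>

lemma cinner_left_ext: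
  assumes "\<And>x. cinner x y = cinner x z"
  shows "y = z"
proof -
  have "cinner (y - z) (y - z) = 0"
    using assms by (simp add: cinner_diff_right)
  then show ?thesis by (simp add: cinner_self)
qed

lemma power2_norm_add_hilbert:
  "(norm (x + y))\<^sup>2 = (norm x)\<^sup>2 + 2 * Re (cinner x y) + (norm (y::'a::complex_hilbert_space))\<^sup>2"
proof -
  have "cinner (x + y) (x + y) = cinner x x + cinner x y + cinner y x + cinner y y"
    by (simp add: cinner_add_left cinner_add_right)
  moreover have "Re (cinner y x) = Re (cinner x y)"
    by (subst cinner_commute) simp
  ultimately have "Re (cinner (x + y) (x + y)) =
      Re (cinner x x) + 2 * Re (cinner x y) + Re (cinner y y)"
    by simp
  then show ?thesis by (simp add: cinner_self)
qed

lemma parallelogram_law_hilbert: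
  "(norm (x + y))\<^sup>2 + (norm (x - y))\<^sup>2 = 2 * (norm x)\<^sup>2 + 2 * (norm (y::'a::complex_hilbert_space))\<^sup>2"
  using power2_norm_add_hilbert[of x y] power2_norm_add_hilbert[of x "- y"]
  by (simp add: cinner_minus_right)

text \<open>The representing vector minimises \<open>\<parallel>x\<parallel>\<^sup>2 - 2 g(x)\<close>; minimising sequences are Cauchy by the
  parallelogram law.\<close>

lemma riesz_representation_Re:
  fixes g :: "'a::complex_hilbert_space \<Rightarrow> real"
  assumes "bounded_linear g"
  obtains z where "\<And>x. g x = Re (cinner x z)"
proof -
  interpret g: bounded_linear g by fact
  define \<phi> where "\<phi> x = (norm x)\<^sup>2 - 2 * g x" for x
  define m where "m = (INF x. \<phi> x)"
  obtain K where K: "\<And>x. norm (g x) \<le> norm x * K" using g.bounded by blast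
  \<comment> \<open>Complete the square: the bound on \<open>g\<close> gives
    \<open>\<phi> x + K\<^sup>2 \<ge> (norm x - K)\<^sup>2\<close>.\<close>
  have "\<phi> x \<ge> - K\<^sup>2" for x
  proof -
    have "g x \<le> norm x * K" using K[of x] by simp
    then show ?thesis
      using zero_le_power2[of "norm x - K"] by (simp add: \<phi>_def power2_diff)
  qed
  then have bdd: "bdd_below (range \<phi>)" by (auto intro!: bdd_belowI)
  have m_le: "m \<le> \<phi> x" for x
    unfolding m_def by (rule cINF_lower[OF bdd]) simp
  have "\<exists>x. \<phi> x < m + inverse (real (Suc n))" for n
    using cINF_less_iff[OF _ bdd, of "m + inverse (real (Suc n))"] by (simp add: m_def)
  then obtain X where X: "\<And>n. \<phi> (X n) < m + inverse (real (Suc n))" by metis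
  \<comment> \<open>The midpoint of \<open>x\<close> and \<open>y\<close> has value at least
    \<open>m\<close>; inserting this into the parallelogram law shows that two near-minimisers are
    close to each other.\<close>
  have gap: "(norm (x - y))\<^sup>2 \<le> 2 * (\<phi> x - m) + 2 * (\<phi> y - m)" for x y
  proof -
    have "m \<le> \<phi> ((1/2) *\<^sub>R (x + y))" by (rule m_le)
    also have "\<dots> = (norm (x + y))\<^sup>2 / 4 - g x - g y"
      by (simp add: \<phi>_def power_mult_distrib power_divide g.scaleR g.add add_divide_distrib)
    finally show ?thesis using parallelogram_law_hilbert[of x y] by (simp add: \<phi>_def)
  qed
  have "Cauchy X"
  proof (rule CauchyI)
    fix e :: real assume "0 < e"
    then obtain M where M: "inverse (real (Suc M)) < e\<^sup>2 / 4"
      using reals_Archimedean[of "e\<^sup>2 / 4"] by auto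
    have "norm (X i - X j) < e" if "M \<le> i" "M \<le> j" for i j
    proof -
      have *: "\<phi> (X k) - m < e\<^sup>2 / 4" if "M \<le> k" for k
      proof -
        have "inverse (real (Suc k)) \<le> inverse (real (Suc M))" using that by (simp add: field_simps)
        then show ?thesis using X[of k] M by linarith
      qed
      have "(norm (X i - X j))\<^sup>2 < e\<^sup>2"
        using gap[of "X i" "X j"] *[OF \<open>M \<le> i\<close>] *[OF \<open>M \<le> j\<close>]
        by (simp add: field_simps)
      then show ?thesis using \<open>0 < e\<close> by (meson power_less_imp_less_base less_imp_le)
    qed
    then show "\<exists>M. \<forall>i\<ge>M. \<forall>j\<ge>M. norm (X i - X j) < e" by blast
  qed
  then obtain z where z: "X \<longlonglongrightarrow> z" using Cauchy_convergent convergent_def by blast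
  have "(\<lambda>n. \<phi> (X n)) \<longlonglongrightarrow> \<phi> z"
    unfolding \<phi>_def by (intro tendsto_intros g.tendsto z)
  moreover have "(\<lambda>n. m + inverse (real (Suc n))) \<longlonglongrightarrow> m + 0"
    by (intro tendsto_intros LIMSEQ_inverse_real_of_nat)
  ultimately have "\<phi> z \<le> m + 0"
    by (rule LIMSEQ_le) (use X less_imp_le in blast)
  then have min: "\<phi> z \<le> \<phi> x" for x using m_le[of x] by simp
  have "g x = Re (cinner x z)" for x
  proof -
    \<comment> \<open>Perturbing the minimiser in direction \<open>x\<close> changes
      \<open>\<phi>\<close> by \<open>2 * t * c + t\<^sup>2 * n\<close>, so \<open>c\<close> is half
      the directional derivative and has to vanish. The chosen \<open>t\<close> makes the change
      negative unless \<open>c = 0\<close>; the denominator \<open>n + 1\<close> instead of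
      \<open>n\<close> also covers \<open>x = 0\<close>.\<close>
    define c where "c = Re (cinner z x) - g x"
    define n where "n = (norm x)\<^sup>2"
    define t where "t = - c / (n + 1)"
    have n: "n \<ge> 0" by (simp add: n_def)
    have "\<phi> z \<le> \<phi> (z + t *\<^sub>R x)" by (rule min)
    then have "0 \<le> 2 * t * c + t\<^sup>2 * n"
      by (simp add: \<phi>_def power2_norm_add_hilbert g.add g.scaleR power_mult_distrib c_def n_def
          cinner_scaleR_right algebra_simps)
    then have "0 \<le> (2 * t * c + t\<^sup>2 * n) * (n + 1)\<^sup>2" by simp
    also have "\<dots> = 2 * (t * (n + 1)) * (n + 1) * c + (t * (n + 1))\<^sup>2 * n" by algebra
    also have "t * (n + 1) = - c" using n by (simp add: t_def)
    also have "2 * (- c) * (n + 1) * c + (- c)\<^sup>2 * n = - (c\<^sup>2 * (n + 2))" by algebra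
    finally have "c\<^sup>2 * (n + 2) \<le> 0" by simp
    then have "c = 0" using n by (simp add: mult_le_0_iff)
    then show ?thesis by (subst cinner_commute) (simp add: c_def)
  qed
  then show ?thesis by (rule that)
qed

text \<open>\<open>cadjoint\<close> is a definite description, so existence and uniqueness both have
  to be shown. Existence is Riesz representation of the real functional
  \<open>Re (cinner (T x) y)\<close> for each fixed \<open>y\<close>.\<close>

lemma cinner_cadjoint:
  assumes "bounded_clinear T"
  shows "cinner (T x) y = cinner x (cadjoint T y)"
proof -
  have T: "bounded_linear T" "\<And>c x. T (c *\<^sub>C x) = c *\<^sub>C T x"
    using assms by (auto simp: bounded_clinear_def)
  have "\<exists>z. \<forall>x. cinner (T x) y = cinner x z" for y
  proof -
    have "bounded_linear (\<lambda>x. Re (cinner (T x) y))"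
      using bounded_linear_compose[OF bounded_linear_Re_cinner_left T(1)] .
    then obtain z where z: "\<And>x. Re (cinner (T x) y) = Re (cinner x z)"
      by (rule riesz_representation_Re) blast
    \<comment> \<open>Replacing \<open>x\<close> by \<open>\<i> *\<^sub>C x\<close> turns the real
      parts into the negated imaginary parts, so the real identity already carries the complex
      one.\<close>
    have "Im (cinner (T x) y) = Im (cinner x z)" for x
      using z[of "\<i> *\<^sub>C x"] by (simp add: T(2) cinner_scaleC_left)
    with z show ?thesis by (metis complex_eqI)
  qed
  then obtain T' where T': "\<forall>x y. cinner (T x) y = cinner x (T' y)" by metis
  have "cadjoint T = T'"
    unfolding cadjoint_def
  proof (rule the_equality)
    fix U assume "\<forall>x y. cinner (T x) y = cinner x (U y)"
    then show "U = T'" using T' by (metis cinner_left_ext ext)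
  qed (rule T')
  with T' show ?thesis by simp
qed

lemma cadjoint_scaleC:
  assumes "bounded_clinear T"
  shows "cadjoint T (c *\<^sub>C y) = c *\<^sub>C cadjoint T y"
  by (rule cinner_left_ext)
    (simp add: cinner_cadjoint[OF assms, symmetric] cinner_scaleC_right)

lemma norm_scaleC: "norm (c *\<^sub>C x) = cmod c * norm (x::'a::complex_hilbert_space)"
proof -
  have "complex_of_real ((norm (c *\<^sub>C x))\<^sup>2) = c * cnj c * complex_of_real ((norm x)\<^sup>2)"
    by (simp only: cinner_self[symmetric] cinner_scaleC_left cinner_scaleC_right mult_ac)
  also have "\<dots> = complex_of_real ((cmod c * norm x)\<^sup>2)"
    by (simp only: complex_norm_square[of c] power_mult_distrib of_real_mult)
  finally have "(norm (c *\<^sub>C x))\<^sup>2 = (cmod c * norm x)\<^sup>2" using of_real_eq_iff by blast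
  then show ?thesis by (simp add: power2_eq_iff_nonneg)
qed

section \<open>Words in the Cuntz isometries\<close>

lemma word_op_Nil [simp]: "word_op T [] = id"
  by (simp add: word_op_def)

lemma word_op_Cons [simp]: "word_op T (i # w) = T i \<circ> word_op T w"
  by (simp add: word_op_def)

lemma word_op_append: "word_op T (u @ w) = word_op T u \<circ> word_op T w"
  by (induction u) (simp_all add: o_assoc)

text \<open>The relation \<open>S_j^* S_j = I\<close> says that each \<open>S j\<close> is an
  isometry.\<close>

lemma cuntz_norm:
  assumes "cuntz_representation N S" "j < N"
  shows "norm (S j x) = norm x"
proof -
  have "cinner (S j x) (S j x) = cinner x x"
    using assms by (simp add: cuntz_representation_def cinner_cadjoint)
  then show ?thesis by (simp only: cinner_self of_real_eq_iff power2_eq_iff_nonneg norm_ge_zero)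
qed

lemma cuntz_norm_word_op:
  assumes "cuntz_representation N S" "set w \<subseteq> {..<N}"
  shows "norm (word_op S w x) = norm x"
  using assms(2) by (induction w) (simp_all add: cuntz_norm[OF assms(1)])

text \<open>In the reversed word the adjoint of the first letter acts first and leaves a multiple of
  \<open>f\<close>. The free scalar \<open>c\<close> collects these eigenvalues so that the
  induction goes through.\<close>

lemma cuntz_eigenvector_word_op:
  assumes S: "cuntz_representation N S" and f: "\<forall>j<N. cadjoint (S j) f = l j *\<^sub>C f"
    and w: "set w \<subseteq> {..<N}"
  shows "word_op (\<lambda>i. cadjoint (S i)) (rev w) (c *\<^sub>C f) = (c * prod_list (map l w)) *\<^sub>C f"
  using w
proof (induction w arbitrary: c)
  case (Cons i w)
  then have "cadjoint (S i) (c *\<^sub>C f) = (c * l i) *\<^sub>C f"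
    using S f by (simp add: cuntz_representation_def cadjoint_scaleC scaleC_scaleC)
  with Cons show ?case by (simp add: word_op_append mult.assoc)
qed simp

text \<open>Pair the resolution of the identity, applied to \<open>f\<close>, with \<open>f\<close>
  itself: the \<open>j\<close>-th term is the squared norm of \<open>cadjoint (S j) f\<close>, and
  the total is the squared norm of \<open>f\<close>.\<close>

lemma cuntz_eigenvalues_sum:
  assumes S: "cuntz_representation N S" and f: "\<forall>j<N. cadjoint (S j) f = l j *\<^sub>C f"
    and "norm f = 1"
  shows "(\<Sum>j<N. (cmod (l j))\<^sup>2) = 1"
proof -
  have "cinner (S j (cadjoint (S j) f)) f = complex_of_real ((cmod (l j))\<^sup>2)" if "j < N" for j
  proof -
    have "cinner (S j (cadjoint (S j) f)) f = cinner (cadjoint (S j) f) (cadjoint (S j) f)"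
      using S that by (simp add: cuntz_representation_def cinner_cadjoint)
    then show ?thesis using f that assms(3) by (simp add: cinner_self norm_scaleC)
  qed
  then have "cinner (\<Sum>j<N. S j (cadjoint (S j) f)) f = complex_of_real (\<Sum>j<N. (cmod (l j))\<^sup>2)"
    by (simp add: cinner_sum_left)
  then have "complex_of_real 1 = complex_of_real (\<Sum>j<N. (cmod (l j))\<^sup>2)"
    using S assms(3) by (simp add: cuntz_representation_def cinner_self)
  then show ?thesis using of_real_eq_iff by metis
qed

section \<open>The N-adic intervals\<close>

lemma nadic_interval_Nil [simp]: "nadic_interval N [] = {0..<1}"
  by (simp add: nadic_interval_def)

text \<open>Prepending the digit \<open>i\<close> moves the left endpoint \<open>a\<close> to
  \<open>(a + i) / N\<close> and divides the length by \<open>N\<close>, which is the action of the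
  increasing affine map \<open>sigma_map N i\<close>. The equivalence holds for all real
  \<open>x\<close>, and it lets the later facts on intervals be proved by recursion on
  words.\<close>

lemma sigma_map_in_nadic_interval_Cons:
  assumes "N > 0"
  shows "sigma_map N i x \<in> nadic_interval N (i # w) \<longleftrightarrow> x \<in> nadic_interval N w"
proof -
  define a where "a = (\<Sum>m<length w. real (w ! m) / real N ^ Suc m)"
  have "(\<Sum>m<length (i # w). real ((i # w) ! m) / real N ^ Suc m) = (real i + a) / real N"
    unfolding list.size(4) add_Suc_right add_0_right sum.lessThan_Suc_shift a_def
    by (simp add: add_divide_distrib sum_divide_distrib mult.commute)
  then have "nadic_interval N (i # w) =
      {(a + real i) / real N..<(a + 1 / real N ^ length w + real i) / real N}"
    by (simp add: nadic_interval_def Let_def add_divide_distrib ac_simps)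
  moreover have "nadic_interval N w = {a..<a + 1 / real N ^ length w}"
    by (simp add: nadic_interval_def Let_def a_def)
  ultimately show ?thesis
    using assms by (simp add: sigma_map_def divide_le_cancel divide_less_cancel)
qed

lemma sigma_map_surj:
  assumes "N > 0"
  obtains y where "x = sigma_map N i y"
proof
  show "x = sigma_map N i (real N * x - real i)" using assms by (simp add: sigma_map_def)
qed

lemma nadic_interval_subset:
  assumes "N > 0" "set w \<subseteq> {..<N}"
  shows "nadic_interval N w \<subseteq> {0..<1}"
  using assms(2)
proof (induction w)
  case (Cons i w)
  show ?case
  proof
    fix x assume x: "x \<in> nadic_interval N (i # w)"
    obtain y where y: "x = sigma_map N i y" using sigma_map_surj assms(1) by blast
    have "y \<in> {0..<1}"
      using x y Cons sigma_map_in_nadic_interval_Cons[OF assms(1)] by auto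
    moreover have "real i + 1 \<le> real N" using Cons.prems by auto
    ultimately show "x \<in> {0..<1}" using y by (simp add: sigma_map_def)
  qed
qed simp

text \<open>Two points of \<open>[0,1)\<close> differ by less than 1, whereas \<open>i\<close> and
  \<open>j\<close> differ by an integer.\<close>

lemma sigma_map_digit_unique:
  assumes "N > 0" "sigma_map N i x = sigma_map N j y" "x \<in> {0..<1}" "y \<in> {0..<1}"
  shows "i = j"
proof -
  have "x + real i = y + real j" using assms by (simp add: sigma_map_def)
  then have "\<bar>real i - real j\<bar> < 1" using assms by auto
  then show ?thesis by linarith
qed

text \<open>For \<open>j = i\<close> the map strips the first letter. For
  \<open>j \<noteq> i\<close> a point of the preimage would have an image with two different first
  digits.\<close>

lemma sigma_map_vimage_nadic_interval:
  assumes "N > 0" "set (i # w) \<subseteq> {..<N}"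
  shows "{x\<in>{0..<1}. sigma_map N j x \<in> nadic_interval N (i # w)} =
    (if j = i then nadic_interval N w else {})"
proof (cases "j = i")
  case True
  then show ?thesis
    using assms nadic_interval_subset[of N w] by (auto simp: sigma_map_in_nadic_interval_Cons)
next
  case False
  have "sigma_map N j x \<notin> nadic_interval N (i # w)" if x: "x \<in> {0..<1}" for x
  proof
    assume A: "sigma_map N j x \<in> nadic_interval N (i # w)"
    obtain y where y: "sigma_map N j x = sigma_map N i y" using sigma_map_surj assms(1) by blast
    then have "y \<in> {0..<1}"
      using A assms nadic_interval_subset[of N w] by (auto simp: sigma_map_in_nadic_interval_Cons)
    with y x False assms(1) show False using sigma_map_digit_unique by blast
  qed
  with False show ?thesis by auto
qed

text \<open>This is the base \<open>N\<close> expansion to \<open>k\<close> digits: the first digit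
  is the integer part of \<open>N * x\<close>, and the expansion continues with the fractional
  part.\<close>

lemma ex_nadic_interval:
  assumes "N > 0" "x \<in> {0..<1}"
  shows "\<exists>w. length w = k \<and> set w \<subseteq> {..<N} \<and> x \<in> nadic_interval N w"
  using assms(2)
proof (induction k arbitrary: x)
  case (Suc k)
  define j where "j = nat \<lfloor>real N * x\<rfloor>"
  define y where "y = real N * x - real j"
  have "real j = of_int \<lfloor>real N * x\<rfloor>" using Suc.prems by (simp add: j_def)
  then have y: "y \<in> {0..<1}" unfolding y_def by simp linarith
  have "real N * x < real N * 1" using Suc.prems assms(1) by (intro mult_strict_left_mono) auto
  then have j: "j < N" using y by (simp add: y_def)
  obtain w where w: "length w = k" "set w \<subseteq> {..<N}" "y \<in> nadic_interval N w"
    using Suc.IH[OF y] by blast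
  have "x = sigma_map N j y" using assms(1) by (simp add: sigma_map_def y_def)
  with w j show ?case
    by (intro exI[of _ "j # w"]) (simp add: sigma_map_in_nadic_interval_Cons assms(1))
qed simp

text \<open>Cylinder sets are nested or disjoint. Equal first letters are removed through the
  injective map \<open>sigma_map N i\<close>, different first letters give disjoint intervals, and
  an exhausted word stands for all of \<open>[0,1)\<close>.\<close>

lemma nadic_interval_Int:
  assumes "N > 0" "set u \<subseteq> {..<N}" "set v \<subseteq> {..<N}"
  shows "nadic_interval N u \<inter> nadic_interval N v \<in> {{}, nadic_interval N u, nadic_interval N v}"
  using assms(2,3)
proof (induction u arbitrary: v)
  case Nil
  then show ?case using nadic_interval_subset[OF assms(1), of v] by (auto simp: Int_absorb1)
next
  case (Cons i u)
  show ?case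
  proof (cases v)
    case Nil
    then show ?thesis using nadic_interval_subset[OF assms(1) Cons.prems(1)] by (auto simp: Int_absorb2)
  next
    case v: (Cons j v')
    have inj: "inj (sigma_map N k)" for k using assms(1) by (auto simp: inj_def sigma_map_def)
    have image: "nadic_interval N (k # w) = sigma_map N k ` nadic_interval N w" for k w
    proof (rule set_eqI)
      fix x
      obtain y where "x = sigma_map N k y" using sigma_map_surj assms(1) by blast
      then show "x \<in> nadic_interval N (k # w) \<longleftrightarrow> x \<in> sigma_map N k ` nadic_interval N w"
        by (simp add: sigma_map_in_nadic_interval_Cons[OF assms(1)] inj_image_mem_iff[OF inj])
    qed
    show ?thesis
    proof (cases "i = j")
      case True
      then have "nadic_interval N (i # u) \<inter> nadic_interval N v =
          sigma_map N i ` (nadic_interval N u \<inter> nadic_interval N v')"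
        by (simp add: v image image_Int[OF inj])
      moreover have "nadic_interval N u \<inter> nadic_interval N v' \<in>
          {{}, nadic_interval N u, nadic_interval N v'}"
        using Cons v by simp
      ultimately show ?thesis
        using True unfolding v image by (metis image_empty insert_iff empty_iff)
    next
      case False
      have "set u \<subseteq> {..<N}" "set v' \<subseteq> {..<N}" using Cons.prems v by auto
      then have "nadic_interval N u \<subseteq> {0..<1}" "nadic_interval N v' \<subseteq> {0..<1}"
        using nadic_interval_subset assms(1) by blast+
      then have "nadic_interval N (i # u) \<inter> nadic_interval N v = {}"
        using False sigma_map_digit_unique[OF assms(1)] unfolding v image by blast
      then show ?thesis by blast
    qed
  qed
qed

lemma nadic_interval_dist:
  assumes "x \<in> nadic_interval N w" "y \<in> nadic_interval N w"
  shows "dist x y < 1 / real N ^ length w"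
  using assms by (auto simp: nadic_interval_def Let_def dist_real_def)

section \<open>Generation of the Borel sets of \<open>[0,1)\<close>\<close>

lemma space_unit_borel [simp]: "space unit_borel = {0..<1}"
  by (simp add: unit_borel_def space_restrict_space)

lemma nadic_interval_sets:
  assumes "N > 0" "set w \<subseteq> {..<N}"
  shows "nadic_interval N w \<in> sets unit_borel"
  using nadic_interval_subset[OF assms]
  by (simp add: unit_borel_def sets_restrict_space_iff) (simp add: nadic_interval_def Let_def)

text \<open>The empty set is added to close the family under intersection; the empty word
  contributes \<open>[0,1)\<close> itself.\<close>

definition nadic_generator :: "nat \<Rightarrow> real set set" where
  "nadic_generator N = insert {} (nadic_interval N ` {w. set w \<subseteq> {..<N}})"

text \<open>The harder inclusion asks that every relatively open set be a countable union of N-adic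
  intervals. It is, since each of its points lies in arbitrarily short such intervals.\<close>

lemma sets_unit_borel:
  assumes "N \<ge> 2"
  shows "sets unit_borel = sigma_sets {0..<1} (nadic_generator N)"
proof
  have N: "N > 0" using assms by simp
  let ?G = "nadic_generator N"
  have G: "?G \<subseteq> Pow {0..<1}"
    using nadic_interval_subset[OF N] by (auto simp: nadic_generator_def)
  show "sigma_sets {0..<1} ?G \<subseteq> sets unit_borel"
    using nadic_interval_sets[OF N] by (intro sets.sigma_sets_subset[of _ unit_borel, simplified])
      (auto simp: nadic_generator_def)
  let ?M = "sigma {0..<1} ?G"
  \<comment> \<open>Measurability of the identity into \<open>borel\<close> can be tested on open
    sets and then yields all Borel sets as preimages.\<close>
  have id: "(\<lambda>x. x) \<in> borel_measurable ?M"
  proof (rule borel_measurableI)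
    fix U :: "real set" assume U: "open U"
    define W where "W = {w. set w \<subseteq> {..<N} \<and> nadic_interval N w \<subseteq> U}"
    have "U \<inter> {0..<1} = (\<Union>w\<in>W. nadic_interval N w)"
    proof
      show "U \<inter> {0..<1} \<subseteq> (\<Union>w\<in>W. nadic_interval N w)"
      proof
        fix x assume x: "x \<in> U \<inter> {0..<1}"
        then obtain e where e: "e > 0" "ball x e \<subseteq> U" using U open_contains_ball by blast
        \<comment> \<open>Here \<open>N \<ge> 2\<close> matters: the lengths \<open>1 / N^k\<close>
          must tend to 0.\<close>
        obtain k where k: "(1 / real N) ^ k < e"
          using real_arch_pow_inv[of e "1 / real N"] e(1) assms by auto
        obtain w where w: "length w = k" "set w \<subseteq> {..<N}" "x \<in> nadic_interval N w"
          using ex_nadic_interval[OF N] x by blast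
        have "nadic_interval N w \<subseteq> ball x e"
          using nadic_interval_dist[OF w(3)] k w(1) by (force simp: power_one_over)
        with e w show "x \<in> (\<Union>w\<in>W. nadic_interval N w)" by (auto simp: W_def)
      qed
    next
      show "(\<Union>w\<in>W. nadic_interval N w) \<subseteq> U \<inter> {0..<1}"
        using nadic_interval_subset[OF N] by (auto simp: W_def)
    qed
    \<comment> \<open>The union is countable because words are lists of natural numbers.\<close>
    moreover have "(\<Union>w\<in>W. nadic_interval N w) \<in> sets ?M"
      using G by (intro sets.countable_UN') (auto simp: W_def nadic_generator_def)
    ultimately show "(\<lambda>x. x) -` U \<inter> space ?M \<in> sets ?M" using G by simp
  qed
  show "sets unit_borel \<subseteq> sigma_sets {0..<1} ?G"
  proof
    fix E assume "E \<in> sets unit_borel"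
    then obtain B where B: "B \<in> sets borel" "E = {0..<1} \<inter> B"
      by (auto simp: unit_borel_def sets_restrict_space)
    have "(\<lambda>x. x) -` B \<inter> space ?M \<in> sets ?M" using id B(1) by (rule measurable_sets)
    then show "E \<in> sigma_sets {0..<1} ?G" using G B(2) by (simp add: Int_commute)
  qed
qed

lemma Int_stable_nadic_generator:
  assumes "N > 0"
  shows "Int_stable (nadic_generator N)"
proof (rule Int_stableI)
  fix A B assume AB: "A \<in> nadic_generator N" "B \<in> nadic_generator N"
  show "A \<inter> B \<in> nadic_generator N"
  proof (cases "A = {} \<or> B = {}")
    case True
    then show ?thesis by (auto simp: nadic_generator_def)
  next
    case False
    then have "A \<inter> B \<in> {{}, A, B}"
      using AB nadic_interval_Int[OF assms] unfolding nadic_generator_def by blast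
    then have "A \<inter> B = {} \<or> A \<inter> B = A \<or> A \<inter> B = B" by simp
    then show ?thesis using AB by (metis insertI1 nadic_generator_def)
  qed
qed

section \<open>Self-similarity of finite measures on \<open>[0,1)\<close>\<close>

lemma sigma_map_measurable:
  assumes "j < N"
  shows "sigma_map N j \<in> measurable unit_borel unit_borel"
  unfolding unit_borel_def
proof (rule measurable_restrict_space3)
  show "sigma_map N j \<in> borel_measurable borel" unfolding sigma_map_def by measurable
  have "real j + 1 \<le> real N" using assms by simp
  then show "sigma_map N j \<in> {0..<1} \<rightarrow> {0..<1}" by (auto simp: sigma_map_def divide_less_eq)
qed

text \<open>Dynkin induction extends the scaling rule on intervals to all Borel sets. On the
  interval of \<open>i # w\<close> only the summand \<open>j = i\<close> survives, and it is the
  right side of \<open>eq\<close>.\<close>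

lemma self_similar_measureI:
  fixes c :: "nat \<Rightarrow> ennreal"
  assumes N: "N \<ge> 2" and M: "sets M = sets unit_borel" and c: "(\<Sum>j<N. c j) = 1"
    and fin: "emeasure M {0..<1} \<noteq> \<infinity>"
    and eq: "\<And>i w. i < N \<Longrightarrow> set w \<subseteq> {..<N} \<Longrightarrow>
      emeasure M (nadic_interval N (i # w)) = c i * emeasure M (nadic_interval N w)"
    and E: "E \<in> sets unit_borel"
  shows "emeasure M E = (\<Sum>j<N. c j * emeasure M {x\<in>{0..<1}. sigma_map N j x \<in> E})"
proof -
  have N0: "N > 0" using N by simp
  have sp [simp]: "space M = {0..<1}" using sets_eq_imp_space_eq[OF M] by simp
  define T where "T j A = {x\<in>{0..<1}. sigma_map N j x \<in> A}" for j A
  \<comment> \<open>The right-hand side is kept as a plain set function; the induction asks only for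
    its value on the generator, its total mass and its additivity, which are established
    next.\<close>
  define \<nu> where "\<nu> A = (\<Sum>j<N. c j * emeasure M (T j A))" for A
  have T_sets: "T j A \<in> sets M" if "j < N" "A \<in> sets unit_borel" for j A
  proof -
    have "T j A = sigma_map N j -` A \<inter> space unit_borel" by (auto simp: T_def)
    then show ?thesis using measurable_sets[OF sigma_map_measurable[OF that(1)] that(2)] M by simp
  qed
  have T_unit: "T j {0..<1} = {0..<1}" if "j < N" for j
    using measurable_space[OF sigma_map_measurable[OF that]]
    unfolding T_def space_unit_borel by blast
  have T_Un: "T j (A \<union> B) = T j A \<union> T j B" for j A B by (auto simp: T_def)
  have T_UN: "T j (\<Union>n. A n) = (\<Union>n. T j (A n))" for j and A :: "nat \<Rightarrow> real set"
    by (auto simp: T_def)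
  have T_disjoint: "T j A \<inter> T j B = {}" if "A \<inter> B = {}" for j A B
    using that by (auto simp: T_def)
  have \<nu>_unit: "\<nu> {0..<1} = emeasure M {0..<1}"
  proof -
    have "\<nu> {0..<1} = (\<Sum>j<N. c j * emeasure M {0..<1})"
      unfolding \<nu>_def by (rule sum.cong) (simp_all only: T_unit lessThan_iff)
    then show ?thesis by (simp only: sum_distrib_right[symmetric] c mult_1_left)
  qed
  have \<nu>_empty: "\<nu> {} = 0" by (simp add: \<nu>_def T_def)
  have \<nu>_Un: "\<nu> (A \<union> B) = \<nu> A + \<nu> B"
    if A: "A \<in> sets unit_borel" and B: "B \<in> sets unit_borel" and AB: "A \<inter> B = {}" for A B
  proof -
    have "c j * emeasure M (T j (A \<union> B)) = c j * emeasure M (T j A) + c j * emeasure M (T j B)"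
      if j: "j < N" for j
      unfolding T_Un distrib_left[symmetric]
      using plus_emeasure[OF T_sets[OF j A] T_sets[OF j B] T_disjoint[OF AB]]
      by simp
    then show ?thesis unfolding \<nu>_def sum.distrib[symmetric] by (intro sum.cong) simp_all
  qed
  have \<nu>_UN: "\<nu> (\<Union>n. A n) = (\<Sum>n. \<nu> (A n))"
    if A: "range A \<subseteq> sets unit_borel" "disjoint_family A" for A :: "nat \<Rightarrow> real set"
  proof -
    have "c j * emeasure M (T j (\<Union>n. A n)) = (\<Sum>n. c j * emeasure M (T j (A n)))"
      if "j < N" for j
    proof -
      have "range (\<lambda>n. T j (A n)) \<subseteq> sets M" using T_sets[OF that] A(1) by blast
      moreover have "disjoint_family (\<lambda>n. T j (A n))"
        using A(2) T_disjoint unfolding disjoint_family_on_def by blast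
      ultimately have "(\<Sum>n. emeasure M (T j (A n))) = emeasure M (T j (\<Union>n. A n))"
        unfolding T_UN by (rule suminf_emeasure)
      then show ?thesis by simp
    qed
    then have "\<nu> (\<Union>n. A n) = (\<Sum>j<N. \<Sum>n. c j * emeasure M (T j (A n)))"
      unfolding \<nu>_def by (intro sum.cong) simp_all
    also have "\<dots> = (\<Sum>n. \<nu> (A n))"
      unfolding \<nu>_def by (rule suminf_sum[symmetric]) simp
    finally show ?thesis .
  qed
  have "Int_stable (nadic_generator N)" by (rule Int_stable_nadic_generator[OF N0])
  moreover have "nadic_generator N \<subseteq> Pow {0..<1}"
    using nadic_interval_subset[OF N0] unfolding nadic_generator_def by blast
  moreover have "E \<in> sigma_sets {0..<1} (nadic_generator N)" using E sets_unit_borel[OF N] by simp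
  ultimately have "emeasure M E = \<nu> E"
  proof (induction rule: sigma_sets_induct_disjoint)
    case (basic A)
    then consider "A = {}" | u where "A = nadic_interval N u" "set u \<subseteq> {..<N}"
      by (auto simp: nadic_generator_def)
    then show ?case
    proof cases
      case 1
      then show ?thesis by (simp add: \<nu>_empty)
    next
      case u: 2
      show ?thesis
      proof (cases u)
        \<comment> \<open>The empty word gives the whole space, where agreement comes from the
          weights summing to 1.\<close>
        case Nil
        then show ?thesis using u(1) by (simp add: \<nu>_unit)
      next
        case (Cons i w)
        have T_A: "T j A = (if j = i then nadic_interval N w else {})" for j
          unfolding T_def u(1) Cons
          by (rule sigma_map_vimage_nadic_interval[OF N0]) (use u(2) Cons in simp)
        have "\<nu> A = (\<Sum>j<N. if j = i then c i * emeasure M (nadic_interval N w) else 0)"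
          unfolding \<nu>_def by (intro sum.cong) (simp_all add: T_A)
        then show ?thesis using u Cons eq[of i w] by simp
      qed
    qed
  next
    case empty
    show ?case by (simp add: \<nu>_empty)
  next
    case (compl A)
    then have A: "A \<in> sets unit_borel" using sets_unit_borel[OF N] by simp
    let ?B = "{0..<1} - A"
    have B: "?B \<in> sets unit_borel" using sets.compl_sets[OF A] by simp
    have AB: "A \<union> ?B = {0..<1}" using sets.sets_into_space[OF A] by auto
    have "\<nu> A + \<nu> ?B = \<nu> {0..<1}"
      using \<nu>_Un[OF A B Diff_disjoint] unfolding AB by simp
    moreover have "emeasure M A + emeasure M ?B = emeasure M {0..<1}"
      using plus_emeasure[of A M ?B] A B M Diff_disjoint unfolding AB by blast
    \<comment> \<open>Cancellation in \<open>ennreal\<close> requires a finite summand; this is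
      where \<open>fin\<close> enters.\<close>
    moreover have "emeasure M A \<noteq> \<infinity>"
      using fin emeasure_space[of M A] neq_top_trans by auto
    ultimately have "emeasure M A + emeasure M ?B = emeasure M A + \<nu> ?B"
      using compl.IH \<nu>_unit by simp
    then show ?case using \<open>emeasure M A \<noteq> \<infinity>\<close> by (simp add: ennreal_add_left_cancel)
  next
    case (union A)
    then have A: "range A \<subseteq> sets unit_borel" using sets_unit_borel[OF N] by simp
    have "emeasure M (\<Union>n. A n) = (\<Sum>n. emeasure M (A n))"
      using suminf_emeasure[of A M] A M union.hyps by simp
    also have "\<dots> = (\<Sum>n. \<nu> (A n))" using union.IH by simp
    also have "\<dots> = \<nu> (\<Union>n. A n)" using \<nu>_UN A union.hyps by simp
    finally show ?case .
  qed
  then show ?thesis by (simp only: \<nu>_def T_def)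
qed

section \<open>The measure of the eigenvector on N-adic intervals\<close>

theorem proposition1p6:
  fixes N :: nat
    and S :: "nat \<Rightarrow> 'a::complex_hilbert_space \<Rightarrow> 'a"
    and P :: "real set \<Rightarrow> 'a \<Rightarrow> 'a"
    and f :: 'a
    and l :: "nat \<Rightarrow> complex"
  assumes "N \<ge> 2"
    and "cuntz_representation N S"
    and "cuntz_pvm N S P"
    and "norm f = 1"
    and "\<forall>j<N. cadjoint (S j) f = l j *\<^sub>C f"
  shows "(\<Sum>j<N. (cmod (l j))\<^sup>2) = 1 \<and>
    (\<forall>E\<in>sets unit_borel.
       emeasure (pvm_measure unit_borel P f) E =
       (\<Sum>j<N. ennreal ((cmod (l j))\<^sup>2) *
          emeasure (pvm_measure unit_borel P f) {x\<in>{0..<1}. sigma_map N j x \<in> E}))"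
proof -
  let ?\<mu> = "pvm_measure unit_borel P f"
  have N: "N > 0" using assms(1) by simp
  have pvm: "projection_valued_measure unit_borel P" using assms(3) by (simp add: cuntz_pvm_def)
  have sum1: "(\<Sum>j<N. (cmod (l j))\<^sup>2) = 1"
    using cuntz_eigenvalues_sum assms by blast
  \<comment> \<open>The adjoints turn \<open>f\<close> into a multiple of \<open>f\<close>, and the
    isometry \<open>word_op S w\<close> preserves its norm. The empty word is excluded because
    \<open>cuntz_pvm\<close> prescribes \<open>P\<close> on nonempty words only.\<close>
  have word: "emeasure ?\<mu> (nadic_interval N w) = ennreal ((cmod (prod_list (map l w)))\<^sup>2)"
    if w: "set w \<subseteq> {..<N}" "w \<noteq> []" for w
  proof -
    have "1 *\<^sub>C f = f" using scaleR_scaleC[of 1 f] by simp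
    then have "P (nadic_interval N w) f = word_op S w (prod_list (map l w) *\<^sub>C f)"
      using assms(3) w cuntz_eigenvector_word_op[OF assms(2,5) w(1), of 1]
      by (simp add: cuntz_pvm_def)
    then show ?thesis
      using w assms(4) nadic_interval_sets[OF N w(1)]
      by (simp add: emeasure_pvm_measure[OF pvm] cuntz_norm_word_op[OF assms(2)] norm_scaleC)
  qed
  have cover: "{0..<1} = (\<Union>j<N. nadic_interval N [j])"
  proof
    show "{0..<1} \<subseteq> (\<Union>j<N. nadic_interval N [j])"
      using ex_nadic_interval[OF N, where k = 1] by (fastforce simp: length_Suc_conv)
  next
    show "(\<Union>j<N. nadic_interval N [j]) \<subseteq> {0..<1}"
      by (intro UN_least nadic_interval_subset N) simp
  qed
  have disj: "disjoint_family_on (\<lambda>j. nadic_interval N [j]) {..<N}"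
    unfolding disjoint_family_on_def
  proof (intro ballI impI)
    fix i j assume ij: "i \<in> {..<N}" "j \<in> {..<N}" "i \<noteq> j"
    have False if "x \<in> nadic_interval N [i]" "x \<in> nadic_interval N [j]" for x
    proof -
      obtain y where y: "x = sigma_map N i y" using sigma_map_surj N by blast
      then have "y \<in> {0..<1}"
        using that(1) by (simp add: sigma_map_in_nadic_interval_Cons[OF N] del: atLeastLessThan_iff)
      moreover have "{x\<in>{0..<1}. sigma_map N i x \<in> nadic_interval N [j]} = {}"
        using ij sigma_map_vimage_nadic_interval[OF N, of j "[]" i] by simp
      ultimately show False using y that(2) by blast
    qed
    then show "nadic_interval N [i] \<inter> nadic_interval N [j] = {}" by blast
  qed
  have sets: "sets ?\<mu> = sets unit_borel"
    unfolding pvm_measure_def by (rule sets.sets_measure_of_eq)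
  have weights: "(\<Sum>j<N. ennreal ((cmod (l j))\<^sup>2)) = 1"
    using sum1 by (subst sum_ennreal) simp_all
  \<comment> \<open>The mass of the empty word is recovered by splitting \<open>[0,1)\<close> into
    the \<open>N\<close> intervals of one-letter words.\<close>
  have "emeasure ?\<mu> {0..<1} = (\<Sum>j<N. emeasure ?\<mu> (nadic_interval N [j]))"
    unfolding cover using disj nadic_interval_sets[OF N] sets
    by (intro sum_emeasure[symmetric]) auto
  also have "\<dots> = (\<Sum>j<N. ennreal ((cmod (l j))\<^sup>2))"
    by (intro sum.cong refl) (simp add: word)
  finally have total: "emeasure ?\<mu> {0..<1} = 1" unfolding weights .
  have scale: "emeasure ?\<mu> (nadic_interval N (i # w)) =
      ennreal ((cmod (l i))\<^sup>2) * emeasure ?\<mu> (nadic_interval N w)"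
    if "i < N" "set w \<subseteq> {..<N}" for i w
  \<comment> \<open>For the empty \<open>w\<close> the total mass 1 takes the place of
    \<open>word\<close>; otherwise the product over \<open>i # w\<close> splits off the factor
    \<open>l i\<close>.\<close>
  proof (cases "w = []")
    case True
    then show ?thesis using that word[of "[i]"] total by simp
  next
    case False
    then show ?thesis
      using that word[of "i # w"] word[of w] by (simp add: norm_mult power_mult_distrib ennreal_mult)
  qed
  have finite: "emeasure ?\<mu> {0..<1} \<noteq> \<infinity>" unfolding total by simp
  show ?thesis
    by (intro conjI ballI sum1 self_similar_measureI[OF assms(1) sets weights finite scale])
qed

end
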